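(* For all real numbers $a,b>0$ with $a\neq b$, writing $A=A(a,b)$, $P=P(a,b)$, $X=X(a,b)$, one has $$(AX)^{1/\alpha_2}<P<\left(AX^{\beta_2}\right)^{1/(1+\beta_2)}$$ with $\alpha_2=2$ and $\beta_2=\dfrac{\log(\pi/2)}{\log(2e/\pi)}\approx 0.8234$, and these constants are best possible (that is, for the inequalities to hold for all $a,b>0$ with $a\neq b$, $\alpha_2$ cannot be replaced by a smaller positive number and $\beta_2$ cannot be replaced by a larger number).
   Context: For $a,b>0$ with $a\neq b$: $A(a,b)=\frac{a+b}{2}$ (arithmetic mean), $G(a,b)=\sqrt{ab}$ (geometric mean), $P(a,b)=\dfrac{a-b}{2\arcsin\left(\frac{a-b}{a+b}\right)}$ (Seiffert mean), and $X(a,b)=A\,e^{G/P-1}$ (Sándor mean). *)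

theory Defs
  imports Complex_Main
begin

definition arith_mean :: "real \<Rightarrow> real \<Rightarrow> real" where
  "arith_mean a b = (a + b) / 2"

definition geom_mean :: "real \<Rightarrow> real \<Rightarrow> real" where
  "geom_mean a b = sqrt (a * b)"

text \<open>The means below are only meant for positive \<open>a \<noteq> b\<close>; for \<open>a = b\<close> the
  formulas take junk values (division by zero).\<close>

definition seiffert_mean :: "real \<Rightarrow> real \<Rightarrow> real" where
  "seiffert_mean a b = (a - b) / (2 * arcsin ((a - b) / (a + b)))"

definition sandor_mean :: "real \<Rightarrow> real \<Rightarrow> real" where
  "sandor_mean a b = arith_mean a b * exp (geom_mean a b / seiffert_mean a b - 1)"

definition alpha2 :: real where
  "alpha2 = 2"

definition beta2 :: real where
  "beta2 = ln (pi / 2) / ln (2 * exp 1 / pi)"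

end

theory Submission
  imports Defs
    "HOL-Analysis.Complex_Transcendental"
    "HOL-Analysis.Harmonic_Numbers"
    "HOL-Real_Asymp.Real_Asymp"
begin

text \<open>
  Put \<open>t = arcsin ((a - b) / (a + b))\<close>, where \<open>a > b\<close> by symmetry, so that \<open>0 < t < pi / 2\<close>.
  The means become \<open>P = A exp (-L)\<close> and \<open>X = A exp (-M)\<close> with \<open>L = ln (t / sin t)\<close> and
  \<open>M = 1 - t cot t\<close> (\<open>means_trig\<close>), and the weighted geometric mean of \<open>A\<close> and \<open>X\<close> with
  weights \<open>1 : \<beta>\<close> is \<open>A exp (-cM)\<close> with \<open>c = \<beta> / (1 + \<beta>)\<close> (\<open>exp_geometric_mean\<close>). Both
  inequalities thus concern the sign of one function, \<open>gap c = L - cM\<close>: the first says that it is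
  negative for \<open>c = 1 / 2\<close>, the second that it is positive for the value \<open>c = ln (pi / 2)\<close>
  belonging to \<open>beta2\<close>.

  As \<open>t\<close> tends to 0, \<open>gap c t\<close> tends to 0, and \<open>gap c (pi / 2) = ln (pi / 2) - c\<close>. The derivative of
  \<open>gap c\<close> is, up to a positive factor, a function \<open>num0 c\<close> of \<open>u = 2 t\<close> that vanishes together with
  its first three derivatives at 0, while the fourth derivative
  \<open>(2 - 4 c) cos u - (1 - c) u sin u\<close> has an evident sign. For \<open>c = 1 / 2\<close> the fourth
  derivative is negative on \<open>(0, pi)\<close>, hence so are the others, and \<open>gap (1 / 2)\<close> decreases from 0
  (\<open>gap_half_neg\<close>). For \<open>c\<close> slightly below \<open>1 / 2\<close> it is first positive and then negative. Since all
  the lower derivatives are negative at \<open>pi\<close>, that sign pattern passes down to \<open>num0 c\<close>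
  (\<open>pos_then_neg_of_deriv\<close>). So \<open>gap c\<close> first rises from 0 and then falls to
  \<open>gap c (pi / 2)\<close>, which is 0 when \<open>c = ln (pi / 2)\<close>, and it is positive in between (\<open>gap_pos\<close>).

  The constant \<open>beta2\<close> cannot be increased, because a larger \<open>\<beta>\<close> makes \<open>gap c\<close> negative at
  \<open>pi / 2\<close> and therefore also slightly before it (\<open>upper_bound_fails\<close>). The constant 2 cannot be
  decreased for reasons of homogeneity: \<open>(A X) powr (1 / \<alpha>)\<close> has degree \<open>2 / \<alpha> > 1\<close>
  in \<open>(a, b)\<close> if \<open>\<alpha> < 2\<close>, whereas \<open>P\<close> has degree 1, so a large common factor of \<open>a\<close> and \<open>b\<close>
  violates the inequality (\<open>lower_bound_fails\<close>).
\<close>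

section \<open>Sign patterns and derivatives\<close>

text \<open>
  The hypothesis at 0 is a limit from the right, because \<open>t / sin t\<close> and \<open>t cos t / sin t\<close> take
  default values at 0 which need not be continuous there.
\<close>
lemma pos_of_deriv_pos:
  fixes f f' :: "real \<Rightarrow> real"
  assumes lim: "(f \<longlongrightarrow> 0) (at_right 0)"
    and der: "\<And>x. 0 < x \<Longrightarrow> x < B \<Longrightarrow> (f has_real_derivative f' x) (at x)"
    and pos: "\<And>x. 0 < x \<Longrightarrow> x < B \<Longrightarrow> f' x > 0"
    and x: "0 < x" "x < B"
  shows "f x > 0"
proof -
  have incr: "f u < f v" if "0 < u" "u < v" "v < B" for u v
    using DERIV_pos_imp_increasing[of u v f] der pos that
    by (meson order_le_less_trans order_less_le_trans)
  have "f u \<le> f (x / 2)" if "u \<in> {0<..<x/2}" for u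
    using incr[of u "x / 2"] that x by auto
  then have "eventually (\<lambda>u. f u \<le> f (x / 2)) (at_right 0)"
    using eventually_at_right_real[of 0 "x / 2"] x by (auto elim: eventually_mono)
  then have "0 \<le> f (x / 2)"
    using tendsto_upperbound[OF lim] by simp
  also have "\<dots> < f x"
    using incr[of "x / 2" x] x by auto
  finally show ?thesis .
qed

definition pos_then_neg :: "(real \<Rightarrow> real) \<Rightarrow> real \<Rightarrow> bool" where
  "pos_then_neg f B \<longleftrightarrow>
     (\<exists>m. 0 < m \<and> m < B \<and> (\<forall>x. 0 < x \<and> x < m \<longrightarrow> f x > 0) \<and> (\<forall>x. m < x \<and> x < B \<longrightarrow> f x < 0))"

text \<open>
  The common part of the two consequences below. The point \<open>m\<close> is the sign change of the derivative:
  up to it \<open>f\<close> has risen above its limit 0, from it on \<open>f\<close> is strictly decreasing, so that the sign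
  of \<open>f\<close> beyond \<open>m\<close> is decided by \<open>f B\<close>.
\<close>
lemma rise_then_fall:
  fixes f f' :: "real \<Rightarrow> real"
  assumes lim: "(f \<longlongrightarrow> 0) (at_right 0)"
    and der: "\<And>x. 0 < x \<Longrightarrow> x \<le> B \<Longrightarrow> (f has_real_derivative f' x) (at x)"
    and sign: "pos_then_neg f' B"
  obtains m where "0 < m" "m < B" "\<And>x. 0 < x \<Longrightarrow> x \<le> m \<Longrightarrow> f x > 0"
    "\<And>u v. m \<le> u \<Longrightarrow> u < v \<Longrightarrow> v \<le> B \<Longrightarrow> f v < f u"
proof -
  obtain m where m: "0 < m" "m < B" "\<And>x. 0 < x \<Longrightarrow> x < m \<Longrightarrow> f' x > 0"
      "\<And>x. m < x \<Longrightarrow> x < B \<Longrightarrow> f' x < 0"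
    using sign unfolding pos_then_neg_def by blast
  have cont: "continuous_on {u..v} f" if "0 < u" "v \<le> B" for u v
    using that by (intro continuous_at_imp_continuous_on ballI DERIV_isCont[OF der]) auto
  have left: "f x > 0" if "0 < x" "x < m" for x
    by (rule pos_of_deriv_pos[where B = m and f' = f', OF lim]) (use der m that in auto)
  have mid: "f m > 0"
  proof -
    have "f (m / 2) < f m"
    proof (rule DERIV_pos_imp_increasing_open[OF _ _ cont])
      show "\<exists>y. (f has_real_derivative y) (at x) \<and> y > 0" if "m / 2 < x" "x < m" for x
        using der[of x] m(2) m(3)[of x] that by auto
    qed (use m in auto)
    moreover have "f (m / 2) > 0"
      using left m by auto
    ultimately show ?thesis by linarith
  qed
  have "f v < f u" if "m \<le> u" "u < v" "v \<le> B" for u v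
  proof (rule DERIV_neg_imp_decreasing_open[OF \<open>u < v\<close> _ cont])
    show "\<exists>y. (f has_real_derivative y) (at x) \<and> y < 0" if "u < x" "x < v" for x
      using der[of x] m(1) m(4)[of x] that \<open>m \<le> u\<close> \<open>v \<le> B\<close> by auto
  qed (use m that in auto)
  with left mid m show thesis
    by (intro that[of m]) (auto simp: le_less)
qed

text \<open>
  If \<open>f B\<close> is negative, the falling part of \<open>f\<close> crosses zero exactly once, so \<open>f\<close> inherits the
  sign pattern of its derivative.
\<close>
lemma pos_then_neg_of_deriv:
  fixes f f' :: "real \<Rightarrow> real"
  assumes lim: "(f \<longlongrightarrow> 0) (at_right 0)"
    and der: "\<And>x. 0 < x \<Longrightarrow> x \<le> B \<Longrightarrow> (f has_real_derivative f' x) (at x)"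
    and sign: "pos_then_neg f' B"
    and end_neg: "f B < 0"
  shows "pos_then_neg f B"
proof -
  obtain m where m: "0 < m" "m < B" and left: "\<And>x. 0 < x \<Longrightarrow> x \<le> m \<Longrightarrow> f x > 0"
    and decr: "\<And>u v. m \<le> u \<Longrightarrow> u < v \<Longrightarrow> v \<le> B \<Longrightarrow> f v < f u"
    using rise_then_fall[OF lim der sign] by blast
  have "\<exists>r\<ge>m. r \<le> B \<and> f r = 0"
    by (rule IVT2) (use left[of m] end_neg m in \<open>auto intro!: DERIV_isCont[OF der]\<close>)
  then obtain r where r: "m \<le> r" "r \<le> B" "f r = 0" by blast
  have "r \<noteq> B" using r end_neg by auto
  moreover have "f x > 0" if "0 < x" "x < r" for x
    using left[of x] decr[of x r] that r by (cases "x \<le> m") auto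
  moreover have "f x < 0" if "r < x" "x < B" for x
    using decr[of r x] that r by auto
  ultimately show ?thesis
    unfolding pos_then_neg_def using m r by (intro exI[of _ r]) auto
qed

lemma pos_of_deriv_pos_then_neg:
  fixes f f' :: "real \<Rightarrow> real"
  assumes lim: "(f \<longlongrightarrow> 0) (at_right 0)"
    and der: "\<And>x. 0 < x \<Longrightarrow> x \<le> B \<Longrightarrow> (f has_real_derivative f' x) (at x)"
    and sign: "pos_then_neg f' B"
    and end_nonneg: "f B \<ge> 0"
    and x: "0 < x" "x < B"
  shows "f x > 0"
proof (rule rise_then_fall[OF lim der sign])
  fix m
  assume left: "\<And>x. 0 < x \<Longrightarrow> x \<le> m \<Longrightarrow> f x > 0"
    and decr: "\<And>u v. m \<le> u \<Longrightarrow> u < v \<Longrightarrow> v \<le> B \<Longrightarrow> f v < f u"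
  show ?thesis
  proof (cases "x \<le> m")
    case True
    then show ?thesis using left x by blast
  next
    case False
    then have "f B < f x" using decr[of x B] x by simp
    then show ?thesis using end_nonneg by simp
  qed
qed

section \<open>The numerator of the derivative\<close>

text \<open>
  The derivative of \<open>gap c\<close> at \<open>t\<close> is \<open>num0 c (2 * t)\<close> divided by \<open>4 t (sin t)\<^sup>2\<close>. Doubling
  the angle makes the numerator linear in \<open>sin\<close> and \<open>cos\<close>, so that repeated differentiation removes
  the polynomial terms. \<open>num1\<close> to \<open>num4\<close> are the successive derivatives of \<open>num0\<close>.
\<close>
definition num0 :: "real \<Rightarrow> real \<Rightarrow> real" where
  "num0 c u = 2 - 2 * cos u - (1 - c) * (u * sin u) - c * u\<^sup>2"

definition num1 :: "real \<Rightarrow> real \<Rightarrow> real" where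
  "num1 c u = 2 * sin u - (1 - c) * (sin u + u * cos u) - 2 * c * u"

definition num2 :: "real \<Rightarrow> real \<Rightarrow> real" where
  "num2 c u = 2 * c * cos u + (1 - c) * (u * sin u) - 2 * c"

definition num3 :: "real \<Rightarrow> real \<Rightarrow> real" where
  "num3 c u = (1 - 3 * c) * sin u + (1 - c) * (u * cos u)"

definition num4 :: "real \<Rightarrow> real \<Rightarrow> real" where
  "num4 c u = (2 - 4 * c) * cos u - (1 - c) * (u * sin u)"

lemma num_derivs:
  "(num0 c has_real_derivative num1 c u) (at u)"
  "(num1 c has_real_derivative num2 c u) (at u)"
  "(num2 c has_real_derivative num3 c u) (at u)"
  "(num3 c has_real_derivative num4 c u) (at u)"
  unfolding num0_def[abs_def] num1_def[abs_def] num2_def[abs_def] num3_def[abs_def] num4_def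
  by (auto intro!: derivative_eq_intros simp: algebra_simps)

lemma num_lims:
  "(num0 c \<longlongrightarrow> 0) (at_right 0)" "(num1 c \<longlongrightarrow> 0) (at_right 0)"
  "(num2 c \<longlongrightarrow> 0) (at_right 0)" "(num3 c \<longlongrightarrow> 0) (at_right 0)"
  unfolding num0_def[abs_def] num1_def[abs_def] num2_def[abs_def] num3_def[abs_def]
  by (auto intro!: tendsto_eq_intros)

text \<open>
  At \<open>c = 1 / 2\<close> the cosine term of \<open>num4 c\<close> drops out and \<open>- u sin u / 2\<close> remains; integrating
  four times from 0 keeps the sign.
\<close>
lemma num0_half_neg:
  assumes "0 < u" "u < pi"
  shows "num0 (1 / 2) u < 0"
proof -
  have step: "f u < 0" if "(f \<longlongrightarrow> 0) (at_right 0)"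
      "\<And>u. (f has_real_derivative f' u) (at u)"
      "\<And>u. 0 < u \<Longrightarrow> u < pi \<Longrightarrow> f' u < 0" "0 < u" "u < pi" for f f' u
    using pos_of_deriv_pos[of "\<lambda>x. - f x" pi "\<lambda>x. - f' x" u]
      tendsto_minus[OF that(1)] DERIV_minus[OF that(2)] that by auto
  have "num4 (1 / 2) u < 0" if "0 < u" "u < pi" for u
    using that by (simp add: num4_def sin_gt_zero)
  then have "num3 (1 / 2) u < 0" if "0 < u" "u < pi" for u
    using step[OF num_lims(4) num_derivs(4)] that by blast
  then have "num2 (1 / 2) u < 0" if "0 < u" "u < pi" for u
    using step[OF num_lims(3) num_derivs(3)] that by blast
  then have "num1 (1 / 2) u < 0" if "0 < u" "u < pi" for u
    using step[OF num_lims(2) num_derivs(2)] that by blast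
  then show ?thesis
    using step[OF num_lims(1) num_derivs(1)] assms by blast
qed

text \<open>
  On \<open>[0, pi / 2]\<close> both \<open>cos u\<close> and \<open>- u sin u\<close> decrease, so there is one sign change; beyond
  \<open>pi / 2\<close> both terms are negative.
\<close>
lemma num4_pos_then_neg:
  assumes c: "c < 1 / 2"
  shows "pos_then_neg (num4 c) pi"
proof -
  have "\<exists>m\<ge>0. m \<le> pi / 2 \<and> num4 c m = 0"
    by (rule IVT2) (use c in \<open>auto simp: num4_def intro!: continuous_intros mult_nonneg_nonneg\<close>)
  then obtain m where m: "0 \<le> m" "m \<le> pi / 2" "num4 c m = 0" by blast
  have mono: "num4 c v < num4 c u" if "0 \<le> u" "u < v" "v \<le> pi / 2" for u v
  proof -
    have "cos v < cos u"
      using that cos_monotone_0_pi[of u v] by auto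
    moreover have "u * sin u \<le> v * sin v"
      using that sin_monotone_2pi_le[of u v] by (intro mult_mono) (auto intro!: sin_ge_zero)
    ultimately have "(2 - 4 * c) * cos v < (2 - 4 * c) * cos u"
      "(1 - c) * (u * sin u) \<le> (1 - c) * (v * sin v)"
      using c by (auto intro!: mult_strict_left_mono mult_left_mono)
    then show ?thesis by (simp add: num4_def)
  qed
  have "num4 c 0 > 0" "num4 c (pi / 2) < 0"
    using c by (auto simp: num4_def)
  then have "0 < m" "m < pi / 2"
    using m by (metis less_eq_real_def less_irrefl)+
  moreover have "num4 c x > 0" if "0 < x" "x < m" for x
    using mono[of x m] m that by auto
  moreover have "num4 c x < 0" if x: "m < x" "x < pi" for x
  proof (cases "x \<le> pi / 2")
    case True
    then show ?thesis using mono[of m x] m x by auto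
  next
    case False
    then have "cos x < 0" "sin x > 0" "0 < x"
      using x cos_monotone_0_pi[of "pi / 2" x] m by (auto intro!: sin_gt_zero)
    then have "(2 - 4 * c) * cos x < 0" "(1 - c) * (x * sin x) > 0"
      using c by (auto simp: mult_less_0_iff)
    then show ?thesis by (simp add: num4_def)
  qed
  ultimately show ?thesis
    unfolding pos_then_neg_def by (intro exI[of _ m]) auto
qed

text \<open>
  The lower bound on \<open>c\<close> makes the values at \<open>pi\<close> negative: \<open>num1 c pi = (1 - 3 c) pi\<close> requires
  \<open>c > 1 / 3\<close>, and \<open>num0 c pi = 4 - c pi\<^sup>2\<close> requires \<open>c > 4 / pi\<^sup>2\<close>, for which
  \<open>9 / 20\<close> suffices since \<open>pi > 3\<close>.
\<close>
lemma num0_pos_then_neg: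
  assumes c: "9 / 20 < c" "c < 1 / 2"
  shows "pos_then_neg (num0 c) pi"
proof -
  have ends: "num3 c pi < 0" "num2 c pi < 0" "num1 c pi < 0"
    using c by (auto simp: num3_def num2_def num1_def algebra_simps)
  have "9 / 20 * 9 < c * pi\<^sup>2"
    using c pi_gt3 power_strict_mono[of 3 pi 2] by (intro mult_strict_mono) auto
  then have end0: "num0 c pi < 0"
    by (simp add: num0_def)
  have "pos_then_neg (num3 c) pi"
    using pos_then_neg_of_deriv[OF num_lims(4) num_derivs(4) num4_pos_then_neg[OF c(2)] ends(1)] .
  from pos_then_neg_of_deriv[OF num_lims(3) num_derivs(3) this ends(2)]
  have "pos_then_neg (num2 c) pi" .
  from pos_then_neg_of_deriv[OF num_lims(2) num_derivs(2) this ends(3)]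
  have "pos_then_neg (num1 c) pi" .
  from pos_then_neg_of_deriv[OF num_lims(1) num_derivs(1) this end0]
  show ?thesis .
qed

section \<open>The two trigonometric inequalities\<close>

definition seiffert_log :: "real \<Rightarrow> real" where
  "seiffert_log t = ln (t / sin t)"

definition sandor_log :: "real \<Rightarrow> real" where
  "sandor_log t = 1 - t * cos t / sin t"

definition gap :: "real \<Rightarrow> real \<Rightarrow> real" where
  "gap c t = seiffert_log t - c * sandor_log t"

lemma gap_deriv:
  assumes t: "0 < t" "t < pi"
  shows "(gap c has_real_derivative num0 c (2 * t) / (4 * t * (sin t)\<^sup>2)) (at t)"
proof -
  have s: "sin t > 0" using t by (rule sin_gt_zero)
  have cc: "cos t * cos t = 1 - sin t * sin t"
    using sin_cos_squared_add3[of t] by linarith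
  have "(seiffert_log has_real_derivative 1 / t - cos t / sin t) (at t)"
    unfolding seiffert_log_def[abs_def] using s t
    by (auto intro!: derivative_eq_intros simp: field_simps)
  moreover have "(sandor_log has_real_derivative (t - sin t * cos t) / (sin t)\<^sup>2) (at t)"
    unfolding sandor_log_def[abs_def] using s t
    by (auto intro!: derivative_eq_intros simp: field_simps power2_eq_square cc)
  ultimately have "(gap c has_real_derivative
      (1 / t - cos t / sin t) - c * ((t - sin t * cos t) / (sin t)\<^sup>2)) (at t)"
    unfolding gap_def[abs_def] by (intro DERIV_diff DERIV_cmult)
  also have "(1 / t - cos t / sin t) - c * ((t - sin t * cos t) / (sin t)\<^sup>2)
      = num0 c (2 * t) / (4 * t * (sin t)\<^sup>2)"
  proof -
    have "num0 c (2 * t)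
        = 4 * (sin t)\<^sup>2 - 4 * (1 - c) * (t * (sin t * cos t)) - 4 * c * t\<^sup>2"
      unfolding num0_def cos_double_sin sin_double by (simp add: algebra_simps power2_eq_square)
    moreover have "(1 / t - cos t / sin t) - c * ((t - sin t * cos t) / (sin t)\<^sup>2)
        = (4 * (sin t)\<^sup>2 - 4 * (1 - c) * (t * (sin t * cos t)) - 4 * c * t\<^sup>2)
          / (4 * t * (sin t)\<^sup>2)"
      using s t by (simp add: field_simps power2_eq_square)
    ultimately show ?thesis by (simp only:)
  qed
  finally show ?thesis .
qed

lemma gap_lim: "(gap c \<longlongrightarrow> 0) (at_right 0)"
  unfolding gap_def[abs_def] seiffert_log_def sandor_log_def by real_asymp

text \<open>The substance of the lower bound for the Seiffert mean.\<close>
lemma gap_half_neg: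
  assumes t: "0 < t" "t < pi / 2"
  shows "gap (1 / 2) t < 0"
proof -
  have "- gap (1 / 2) t > 0"
  proof (rule pos_of_deriv_pos[where B = "pi / 2" and f = "\<lambda>t. - gap (1 / 2) t"
        and f' = "\<lambda>x. - (num0 (1 / 2) (2 * x) / (4 * x * (sin x)\<^sup>2))"])
    show "((\<lambda>t. - gap (1 / 2) t) \<longlongrightarrow> 0) (at_right 0)"
      using tendsto_minus[OF gap_lim] by simp
    show "((\<lambda>t. - gap (1 / 2) t) has_real_derivative
        - (num0 (1 / 2) (2 * x) / (4 * x * (sin x)\<^sup>2))) (at x)" if "0 < x" "x < pi / 2" for x
      using that by (intro DERIV_minus gap_deriv) auto
    show "- (num0 (1 / 2) (2 * x) / (4 * x * (sin x)\<^sup>2)) > 0" if "0 < x" "x < pi / 2" for x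
      using num0_half_neg[of "2 * x"] sin_gt_zero[of x] that by (auto simp: divide_less_0_iff)
  qed (use t in auto)
  then show ?thesis by simp
qed

text \<open>
  The substance of the upper bound for the Seiffert mean. The condition \<open>c \<le> ln (pi / 2)\<close> says
  that \<open>gap c\<close> is nonnegative at the right end \<open>pi / 2\<close>; after rising and falling it
  cannot have reached 0 any earlier.
\<close>
lemma gap_pos:
  assumes c: "9 / 20 < c" "c < 1 / 2" "c \<le> ln (pi / 2)"
    and t: "0 < t" "t < pi / 2"
  shows "gap c t > 0"
proof -
  obtain m where m: "0 < m" "m < pi" "\<And>x. 0 < x \<Longrightarrow> x < m \<Longrightarrow> num0 c x > 0"
      "\<And>x. m < x \<Longrightarrow> x < pi \<Longrightarrow> num0 c x < 0"
    using num0_pos_then_neg[OF c(1,2)] unfolding pos_then_neg_def by blast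
  have sign: "pos_then_neg (\<lambda>t. num0 c (2 * t) / (4 * t * (sin t)\<^sup>2)) (pi / 2)"
    unfolding pos_then_neg_def
  proof (intro exI[of _ "m / 2"] conjI allI impI; (elim conjE)?)
    fix x assume x: "0 < x" "x < m / 2"
    then show "num0 c (2 * x) / (4 * x * (sin x)\<^sup>2) > 0"
      using m(2) m(3)[of "2 * x"] sin_gt_zero[of x] by auto
  next
    fix x assume x: "m / 2 < x" "x < pi / 2"
    then show "num0 c (2 * x) / (4 * x * (sin x)\<^sup>2) < 0"
      using m(1) m(4)[of "2 * x"] sin_gt_zero[of x] by (auto simp: divide_less_0_iff)
  qed (use m in auto)
  have deriv: "(gap c has_real_derivative num0 c (2 * x) / (4 * x * (sin x)\<^sup>2)) (at x)"
    if "0 < x" "x \<le> pi / 2" for x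
    using that by (intro gap_deriv) auto
  have "gap c (pi / 2) \<ge> 0"
    using c by (simp add: gap_def seiffert_log_def sandor_log_def)
  from pos_of_deriv_pos_then_neg[OF gap_lim deriv sign this t]
  show ?thesis .
qed

section \<open>The means in trigonometric coordinates\<close>

lemma means_trig:
  assumes A: "A > 0" and t: "0 < t" "t < pi / 2"
    and a: "a = A * (1 + sin t)" and b: "b = A * (1 - sin t)"
  shows "arith_mean a b = A"
    and "seiffert_mean a b = A * exp (- seiffert_log t)"
    and "sandor_mean a b = A * exp (- sandor_log t)"
proof -
  have s: "sin t > 0" using t by (rule sin_gt_zero2)
  have co: "cos t > 0" using t by (rule cos_gt_zero)
  show am: "arith_mean a b = A"
    by (simp add: arith_mean_def a b algebra_simps)
  have "(a - b) / (a + b) = sin t"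
    using A by (simp add: a b field_simps)
  moreover have "arcsin (sin t) = t"
    using t by (intro arcsin_sin) auto
  ultimately have P: "seiffert_mean a b = A * sin t / t"
    by (simp add: seiffert_mean_def a b algebra_simps)
  have "exp (- seiffert_log t) = sin t / t"
    using s t by (simp add: seiffert_log_def exp_minus)
  then show "seiffert_mean a b = A * exp (- seiffert_log t)"
    using P by simp
  have "a * b = (A * cos t)\<^sup>2"
    by (simp add: a b cos_squared_eq power_mult_distrib) (simp add: algebra_simps power2_eq_square)
  then have "geom_mean a b = A * cos t"
    using A co by (simp add: geom_mean_def)
  then have "geom_mean a b / seiffert_mean a b = (A * cos t) / (A * sin t / t)"
    by (simp only: P)
  also have "\<dots> = t * cos t / sin t"
    using A by simp
  finally have "geom_mean a b / seiffert_mean a b - 1 = - sandor_log t"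
    by (simp add: sandor_log_def)
  then show "sandor_mean a b = A * exp (- sandor_log t)"
    using am by (simp add: sandor_mean_def)
qed

lemma means_commute:
  assumes "a > 0" "b > 0"
  shows "arith_mean a b = arith_mean b a"
    and "seiffert_mean a b = seiffert_mean b a"
    and "sandor_mean a b = sandor_mean b a"
proof -
  show A: "arith_mean a b = arith_mean b a"
    by (simp add: arith_mean_def)
  have "arcsin ((b - a) / (b + a)) = arcsin (- ((a - b) / (a + b)))"
    by (simp add: add.commute minus_divide_left)
  also have "\<dots> = - arcsin ((a - b) / (a + b))"
    using assms by (intro arcsin_minus) (auto simp: field_simps)
  finally show P: "seiffert_mean a b = seiffert_mean b a"
    by (simp add: seiffert_mean_def minus_divide_left)
  show "sandor_mean a b = sandor_mean b a"
    by (simp add: sandor_mean_def A P geom_mean_def mult.commute)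
qed

text \<open>The scale \<open>A\<close> is the arithmetic mean of \<open>a\<close> and \<open>b\<close>.\<close>
lemma trig_parametrization:
  fixes a b :: real
  assumes "0 < b" "b < a"
  obtains A t where "A > 0" "0 < t" "t < pi / 2" "a = A * (1 + sin t)" "b = A * (1 - sin t)"
proof
  define z where "z = (a - b) / (a + b)"
  have z: "0 < z" "z < 1" using assms by (auto simp: z_def)
  show "(a + b) / 2 > 0" using assms by simp
  show "0 < arcsin z" "arcsin z < pi / 2"
    using z arcsin_less_arcsin[of 0 z] arcsin_less_arcsin[of z 1] by auto
  have "(a + b) * z = a - b"
    using assms by (simp add: z_def)
  then show "a = (a + b) / 2 * (1 + sin (arcsin z))" "b = (a + b) / 2 * (1 - sin (arcsin z))"
    using z by (auto simp: field_simps)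
qed

lemma exp_geometric_mean:
  fixes A \<beta> y :: real
  assumes "A > 0" "\<beta> > -1"
  shows "(A * (A * exp (- y)) powr \<beta>) powr (1 / (1 + \<beta>)) = A * exp (- (\<beta> / (1 + \<beta>) * y))"
proof -
  define r where "r = ln A"
  have A: "A = exp r" using exp_ln[OF assms(1)] by (simp add: r_def)
  have eq: "1 / (1 + \<beta>) * (r + \<beta> * (r - y)) = r - \<beta> / (1 + \<beta>) * y"
  proof -
    have "r + \<beta> * (r - y) = (1 + \<beta>) * r - \<beta> * y"
      by (simp add: algebra_simps)
    then show ?thesis
      using assms by (simp add: diff_divide_distrib)
  qed
  have "(A * (A * exp (- y)) powr \<beta>) powr (1 / (1 + \<beta>))
      = exp (1 / (1 + \<beta>) * (r + \<beta> * (r - y)))"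
    by (simp add: A powr_def flip: exp_add)
  also have "\<dots> = A * exp (- (\<beta> / (1 + \<beta>) * y))"
    unfolding eq A by (simp flip: exp_add)
  finally show ?thesis .
qed

section \<open>Numerical values of the constants\<close>

text \<open>
  These bounds must be sharp enough to confine \<open>beta2\<close>, which is \<open>c / (1 - c)\<close> for
  \<open>c = ln (pi / 2)\<close>, to the interval from 0.8234 to 0.82345, which corresponds to
  \<open>c\<close> between about 0.451574 and 0.451589. Four terms of the series of \<open>ln\<close> in \<open>(x - 1) / (x + 1)\<close> have an
  error below \<open>10\<close> to the power \<open>-6\<close> near \<open>pi / 2\<close>.
\<close>
lemma ln_half_pi_bounds: "0.45158 < ln (pi / 2)" "ln (pi / 2) < 0.451588"
proof -
  define x y :: real where "x = 1.570796" and "y = 1.570797"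
  have "0.45158 < ln x" "ln y < 0.451588"
    using ln_approx_bounds[of x 4] ln_approx_bounds[of y 4]
    by (auto simp: x_def y_def eval_nat_numeral)
  moreover have "ln x \<le> ln (pi / 2)" "ln (pi / 2) \<le> ln y"
    using pi_approx by (auto simp: x_def y_def)
  ultimately show "0.45158 < ln (pi / 2)" "ln (pi / 2) < 0.451588"
    by simp_all
qed

lemma beta2_eq: "beta2 = ln (pi / 2) / (1 - ln (pi / 2))"
proof -
  have "ln (2 * exp 1 / pi) = 1 - ln (pi / 2)"
    by (simp add: ln_div ln_mult)
  then show ?thesis by (simp add: beta2_def)
qed

lemma beta2_bounds: "0.8234 < beta2" "beta2 < 0.82345"
  using ln_half_pi_bounds by (auto simp: beta2_eq field_simps)

lemma beta2_weight: "beta2 / (1 + beta2) = ln (pi / 2)"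
  using ln_half_pi_bounds by (simp add: beta2_eq field_simps)

section \<open>The inequalities and their sharpness\<close>

lemma sandor_seiffert_bounds:
  assumes ab: "a > 0" "b > 0" "a \<noteq> b"
  shows "(arith_mean a b * sandor_mean a b) powr (1 / 2) < seiffert_mean a b"
    and "seiffert_mean a b < (arith_mean a b * sandor_mean a b powr beta2) powr (1 / (1 + beta2))"
proof -
  have "(arith_mean a b * sandor_mean a b) powr (1 / 2) < seiffert_mean a b \<and>
      seiffert_mean a b < (arith_mean a b * sandor_mean a b powr beta2) powr (1 / (1 + beta2))"
    if ba: "b > 0" "b < a" for a b
  proof -
    obtain A t where At: "A > 0" "0 < t" "t < pi / 2" "a = A * (1 + sin t)" "b = A * (1 - sin t)"
      using trig_parametrization[OF ba] by blast
    have "gap (1 / 2) t < 0" "gap (ln (pi / 2)) t > 0"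
      using gap_half_neg gap_pos[of "ln (pi / 2)"] ln_half_pi_bounds At(2,3) by auto
    moreover have "(A * (A * exp (- sandor_log t))) powr (1 / 2) = A * exp (- (1 / 2 * sandor_log t))"
      using exp_geometric_mean[of A 1 "sandor_log t"] At(1) by simp
    moreover have "(A * (A * exp (- sandor_log t)) powr beta2) powr (1 / (1 + beta2))
        = A * exp (- (ln (pi / 2) * sandor_log t))"
      using exp_geometric_mean[of A beta2 "sandor_log t"] At(1) beta2_bounds
      by (simp add: beta2_weight)
    ultimately show ?thesis
      using At(1) unfolding means_trig[OF At] gap_def by simp
  qed
  then have "(arith_mean a b * sandor_mean a b) powr (1 / 2) < seiffert_mean a b \<and>
      seiffert_mean a b < (arith_mean a b * sandor_mean a b powr beta2) powr (1 / (1 + beta2))"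
    using ab means_commute[OF ab(1,2)] by (metis linorder_neqE)
  then show "(arith_mean a b * sandor_mean a b) powr (1 / 2) < seiffert_mean a b"
    "seiffert_mean a b < (arith_mean a b * sandor_mean a b powr beta2) powr (1 / (1 + beta2))"
    by blast+
qed

text \<open>
  The pair is taken at the angle \<open>pi / 4\<close>, though any fixed angle would do, and scaled by
  \<open>exp r\<close>. The logarithms of the two sides are \<open>r - L\<close> and \<open>(2 r - M) / \<alpha>\<close>, and \<open>r\<close> is the
  value at which they agree, which exists because \<open>2 / \<alpha> \<noteq> 1\<close>.
\<close>
lemma lower_bound_fails:
  assumes \<alpha>: "0 < \<alpha>" "\<alpha> < 2"
  obtains a b where "a > 0" "b > 0" "a \<noteq> b"
    "seiffert_mean a b \<le> (arith_mean a b * sandor_mean a b) powr (1 / \<alpha>)"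
proof -
  define t where "t = pi / 4"
  define L where "L = seiffert_log t"
  define M where "M = sandor_log t"
  define r where "r = (M / \<alpha> - L) / (2 / \<alpha> - 1)"
  define a where "a = exp r * (1 + sin t)"
  define b where "b = exp r * (1 - sin t)"
  have t: "0 < t" "t < pi / 2" by (auto simp: t_def)
  have s: "0 < sin t" "sin t < 1"
    using t sin_gt_zero[of t] sin_monotone_2pi[of t "pi / 2"] by auto
  have "2 / \<alpha> - 1 > 0" using \<alpha> by (simp add: field_simps)
  then have "r * (2 / \<alpha> - 1) = M / \<alpha> - L"
    unfolding r_def by (intro nonzero_eq_divide_eq[THEN iffD1, OF _ refl]) linarith
  then have "r - L = (r + (r - M)) / \<alpha>"
    by (simp add: diff_divide_distrib add_divide_distrib algebra_simps)
  moreover have "(exp r * (exp r * exp (- M))) powr (1 / \<alpha>) = exp ((r + (r - M)) / \<alpha>)"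
    by (simp add: powr_def flip: exp_add)
  ultimately have eq: "exp r * exp (- L) = (exp r * (exp r * exp (- M))) powr (1 / \<alpha>)"
    by (simp flip: exp_add)
  show thesis
  proof (rule that[of a b])
    show "a > 0" "b > 0" "a \<noteq> b" using s by (auto simp: a_def b_def)
    show "seiffert_mean a b \<le> (arith_mean a b * sandor_mean a b) powr (1 / \<alpha>)"
      unfolding means_trig[OF exp_gt_zero t a_def b_def] using eq by (simp add: L_def M_def)
  qed
qed

text \<open>
  The weight \<open>d = \<beta> / (1 + \<beta>)\<close> increases with \<open>\<beta>\<close>, so it exceeds \<open>ln (pi / 2)\<close>. Then
  \<open>gap d\<close> is negative at \<open>pi / 2\<close>, the degenerate case \<open>b = 0\<close>, and by continuity at some angle
  below \<open>pi / 2\<close>, which gives admissible \<open>a\<close> and \<open>b\<close>.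
\<close>
lemma upper_bound_fails:
  assumes \<beta>: "beta2 < \<beta>"
  obtains a b where "a > 0" "b > 0" "a \<noteq> b"
    "(arith_mean a b * sandor_mean a b powr \<beta>) powr (1 / (1 + \<beta>)) \<le> seiffert_mean a b"
proof -
  define d where "d = \<beta> / (1 + \<beta>)"
  have \<beta>0: "\<beta> > 0" using \<beta> beta2_bounds by simp
  have "beta2 / (1 + beta2) < d"
    using \<beta> \<beta>0 beta2_bounds by (simp add: d_def field_simps)
  then have "gap d (pi / 2) < 0"
    by (simp add: beta2_weight gap_def seiffert_log_def sandor_log_def)
  moreover have "(gap d \<longlongrightarrow> gap d (pi / 2)) (at_left (pi / 2))"
    using DERIV_isCont[OF gap_deriv[of "pi / 2" d]]
    by (simp add: isCont_def filterlim_at_split)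
  ultimately have "eventually (\<lambda>t. gap d t < 0) (at_left (pi / 2))"
    by (intro order_tendstoD)
  moreover have "eventually (\<lambda>t. t \<in> {0<..<pi / 2}) (at_left (pi / 2))"
    by (rule eventually_at_left_real) simp
  ultimately have "eventually (\<lambda>t. gap d t < 0 \<and> t \<in> {0<..<pi / 2}) (at_left (pi / 2))"
    by (rule eventually_conj)
  then obtain t where t: "gap d t < 0" "0 < t" "t < pi / 2"
    using eventually_happens trivial_limit_at_left_real by fastforce
  define a where "a = 1 * (1 + sin t)"
  define b where "b = 1 * (1 - sin t)"
  have s: "0 < sin t" "sin t < 1"
    using t sin_gt_zero[of t] sin_monotone_2pi[of t "pi / 2"] by auto
  show thesis
  proof (rule that[of a b])
    show "a > 0" "b > 0" "a \<noteq> b" using s by (auto simp: a_def b_def)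
    show "(arith_mean a b * sandor_mean a b powr \<beta>) powr (1 / (1 + \<beta>)) \<le> seiffert_mean a b"
      unfolding means_trig[OF zero_less_one t(2,3) a_def b_def]
      using exp_geometric_mean[of 1 \<beta> "sandor_log t"] \<beta>0 t(1)
      by (simp add: gap_def d_def)
  qed
qed

theorem theorem1p11:
  shows "(\<forall>a b::real. a > 0 \<longrightarrow> b > 0 \<longrightarrow> a \<noteq> b \<longrightarrow>
            (arith_mean a b * sandor_mean a b) powr (1 / alpha2) < seiffert_mean a b \<and>
            seiffert_mean a b < (arith_mean a b * sandor_mean a b powr beta2) powr (1 / (1 + beta2)))
    \<and> \<bar>beta2 - 0.8234\<bar> < 0.00005
    \<and> (\<forall>\<alpha>::real. 0 < \<alpha> \<longrightarrow> \<alpha> < alpha2 \<longrightarrow>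
          \<not> (\<forall>a b::real. a > 0 \<longrightarrow> b > 0 \<longrightarrow> a \<noteq> b \<longrightarrow>
               (arith_mean a b * sandor_mean a b) powr (1 / \<alpha>) < seiffert_mean a b))
    \<and> (\<forall>\<beta>::real. beta2 < \<beta> \<longrightarrow>
          \<not> (\<forall>a b::real. a > 0 \<longrightarrow> b > 0 \<longrightarrow> a \<noteq> b \<longrightarrow>
               seiffert_mean a b < (arith_mean a b * sandor_mean a b powr \<beta>) powr (1 / (1 + \<beta>))))"
proof (intro conjI allI impI)
  fix a b :: real
  assume ab: "a > 0" "b > 0" "a \<noteq> b"
  show "(arith_mean a b * sandor_mean a b) powr (1 / alpha2) < seiffert_mean a b"
    using sandor_seiffert_bounds(1)[OF ab] by (simp add: alpha2_def)
  show "seiffert_mean a b < (arith_mean a b * sandor_mean a b powr beta2) powr (1 / (1 + beta2))"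
    by (rule sandor_seiffert_bounds(2)[OF ab])
next
  show "\<bar>beta2 - 0.8234\<bar> < 0.00005"
    using beta2_bounds by (auto simp: abs_less_iff)
next
  fix \<alpha> :: real
  assume "0 < \<alpha>" "\<alpha> < alpha2"
  then show "\<not> (\<forall>a b::real. a > 0 \<longrightarrow> b > 0 \<longrightarrow> a \<noteq> b \<longrightarrow>
      (arith_mean a b * sandor_mean a b) powr (1 / \<alpha>) < seiffert_mean a b)"
    using lower_bound_fails[of \<alpha>] unfolding alpha2_def by (metis not_less)
next
  fix \<beta> :: real
  assume "beta2 < \<beta>"
  then show "\<not> (\<forall>a b::real. a > 0 \<longrightarrow> b > 0 \<longrightarrow> a \<noteq> b \<longrightarrow>
      seiffert_mean a b < (arith_mean a b * sandor_mean a b powr \<beta>) powr (1 / (1 + \<beta>)))"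
    using upper_bound_fails[of \<beta>] by (metis not_less)
qed

end
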